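(* For all positive integers $n$ and $m$, $$\psi_{sq}(K_n\circ\overline{K_m})=mn+\left\lceil\frac{m}{n}\left\lfloor\frac{n}{m}\right\rfloor\right\rceil=\begin{cases}mn,&1\le n<m,\\ mn+1,&1\le m\le n.\end{cases}$$
   Context: All graphs are finite, simple and undirected. $K_n$ is the complete graph on $n$ vertices and $\overline{K_m}$ the edgeless graph on $m$ vertices. The corona $G\circ H$ is obtained from one copy of $G$ and $|V(G)|$ disjoint copies of $H$ by joining the $i$th vertex of $G$ to every vertex in the $i$th copy of $H$. $N_G[v]$ denotes the closed neighborhood of $v$ in $G$. A sub-quorum coloring of $G$ with $k$ colors is an onto partial map $f:V(G)\dashrightarrow\{1,\ldots,k\}$ such that, with $S=\operatorname{dom}(f)$, every $v\in S$ satisfies $|\{u\in N_G[v]\cap S: f(u)=f(v)\}|\ge\frac12|N_G[v]\cap S|$; $\psi_{sq}(G)$ is the maximum such $k$. *)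

theory Defs
  imports Complex_Main
begin

record 'a ugraph =
  verts :: "'a set"
  edges :: "'a set set"

definition simple_graph :: "'a ugraph \<Rightarrow> bool" where
  "simple_graph G \<longleftrightarrow> finite (verts G) \<and> (\<forall>e\<in>edges G. e \<subseteq> verts G \<and> card e = 2)"

definition complete_graph :: "nat \<Rightarrow> nat ugraph" where
  "complete_graph n =
     \<lparr>verts = {1..n}, edges = {{u, v} | u v. u \<in> {1..n} \<and> v \<in> {1..n} \<and> u \<noteq> v}\<rparr>"

definition edgeless_graph :: "nat \<Rightarrow> nat ugraph" where
  "edgeless_graph m = \<lparr>verts = {1..m}, edges = {}\<rparr>"

text \<open>The vertex \<open>Inl v\<close> is the vertex \<open>v\<close> of the copy of \<open>G\<close>; the vertex \<open>Inr (v, w)\<close> is the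
  vertex \<open>w\<close> in the copy of \<open>H\<close> attached to \<open>v\<close>.\<close>

definition corona :: "'a ugraph \<Rightarrow> 'b ugraph \<Rightarrow> ('a + 'a \<times> 'b) ugraph" where
  "corona G H =
     \<lparr>verts = Inl ` verts G \<union> Inr ` (verts G \<times> verts H),
      edges = {Inl ` e | e. e \<in> edges G}
            \<union> {(\<lambda>w. Inr (v, w)) ` e | v e. v \<in> verts G \<and> e \<in> edges H}
            \<union> {{Inl v, Inr (v, w)} | v w. v \<in> verts G \<and> w \<in> verts H}\<rparr>"

definition closed_nbhd :: "'a ugraph \<Rightarrow> 'a \<Rightarrow> 'a set" where
  "closed_nbhd G v = insert v {u. {u, v} \<in> edges G}"

definition sub_quorum_coloring :: "'a ugraph \<Rightarrow> nat \<Rightarrow> ('a \<rightharpoonup> nat) \<Rightarrow> bool" where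
  "sub_quorum_coloring G k f \<longleftrightarrow>
     dom f \<subseteq> verts G \<and> ran f = {1..k} \<and>
     (\<forall>v\<in>dom f. real (card {u \<in> closed_nbhd G v \<inter> dom f. f u = f v})
                  \<ge> 1/2 * real (card (closed_nbhd G v \<inter> dom f)))"

text \<open>For a finite graph the maximum is over a finite nonempty set: see
  \<open>finite_sub_quorum_numbers\<close> and \<open>sub_quorum_coloring_empty\<close> below.\<close>

definition psi_sq :: "'a ugraph \<Rightarrow> nat" where
  "psi_sq G = Max {k. \<exists>f. sub_quorum_coloring G k f}"

lemma sub_quorum_coloring_empty: "sub_quorum_coloring G 0 Map.empty"
  by (simp add: sub_quorum_coloring_def)

lemma finite_sub_quorum_numbers:
  assumes "simple_graph G"
  shows "finite {k. \<exists>f. sub_quorum_coloring G k f}"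
proof -
  have fin: "finite (verts G)"
    using assms by (simp add: simple_graph_def)
  have "k \<le> card (verts G)" if "sub_quorum_coloring G k f" for k f
  proof -
    have d: "dom f \<subseteq> verts G" and r: "ran f = {1..k}"
      using that by (auto simp: sub_quorum_coloring_def)
    have "ran f = (\<lambda>x. the (f x)) ` dom f"
      by (force simp: ran_def dom_def)
    then have "card (ran f) \<le> card (dom f)"
      using card_image_le finite_subset[OF d fin] by metis
    also have "\<dots> \<le> card (verts G)"
      by (rule card_mono[OF fin d])
    finally show ?thesis
      by (simp add: r)
  qed
  then show ?thesis
    by (auto intro: finite_subset[of _ "{..card (verts G)}"])
qed

lemma simple_graph_complete_graph: "simple_graph (complete_graph n)"
  by (auto simp: simple_graph_def complete_graph_def card_2_iff)

lemma simple_graph_edgeless_graph: "simple_graph (edgeless_graph m)"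
  by (simp add: simple_graph_def edgeless_graph_def)

lemma simple_graph_corona:
  assumes "simple_graph G" "simple_graph H"
  shows "simple_graph (corona G H)"
proof -
  have "card ((\<lambda>w. Inr (v, w) :: 'a + 'a \<times> 'b) ` e) = card e" for v e
    by (rule card_image) (simp add: inj_on_def)
  moreover have "card ((Inl :: 'a \<Rightarrow> 'a + 'a \<times> 'b) ` e) = card e" for e
    by (rule card_image) simp
  ultimately show ?thesis
    using assms unfolding simple_graph_def corona_def by fastforce
qed

end

theory Submission
  imports Defs
begin

text \<open>
  Call the vertices of the complete graph \<^emph>\<open>stems\<close> and the other \<open>m * n\<close> vertices
  \<^emph>\<open>leaves\<close>.

  Lower bound: giving all leaves different colours, and leaving the stems uncoloured, uses
  \<open>m * n\<close> colours. If \<open>m \<le> n\<close>, all stems may in addition share one new colour: a stem then sees its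
  own colour \<open>n\<close> times among \<open>n + m\<close> vertices, and a leaf sees just itself and its stem, where one
  half is enough.

  Upper bound: for a given colouring, let a leaf \<^emph>\<open>represent\<close> its own colour, or the colour of its
  stem if the leaf is uncoloured. At most \<open>m * n\<close> colours are represented. If a colour \<open>c\<close> is not
  represented, then only stems carry it, and all \<open>m\<close> leaves at such a stem are coloured, by
  colours other than \<open>c\<close>. The quorum condition at that stem then says that \<open>a + m \<le> 2 * a\<^sub>c\<close>, where
  \<open>a\<close> stems are coloured and \<open>a\<^sub>c\<close> of them have colour \<open>c\<close> (lemma \<open>unrepresented_colour_majority\<close>).
  So \<open>c\<close> occupies more than half of the coloured stems, which only one colour can do, and
  \<open>m \<le> a\<^sub>c \<le> n\<close>.
\<close>

section \<open>Neighbourhoods in the corona\<close>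

abbreviation clique_corona :: "nat \<Rightarrow> nat \<Rightarrow> (nat + nat \<times> nat) ugraph" where
  "clique_corona n m \<equiv> corona (complete_graph n) (edgeless_graph m)"

lemma verts_clique_corona:
  "verts (clique_corona n m) = Inl ` {1..n} \<union> Inr ` ({1..n} \<times> {1..m})"
  by (simp add: corona_def complete_graph_def edgeless_graph_def)

lemma edges_clique_corona:
  "edges (clique_corona n m) =
     {{Inl u, Inl v} | u v. u \<in> {1..n} \<and> v \<in> {1..n} \<and> u \<noteq> v}
     \<union> {{Inl v, Inr (v, w)} | v w. v \<in> {1..n} \<and> w \<in> {1..m}}"
proof -
  have "{Inl ` e | e. e \<in> edges (complete_graph n)} =
      {{Inl u, Inl v :: nat + nat \<times> nat} | u v. u \<in> {1..n} \<and> v \<in> {1..n} \<and> u \<noteq> v}"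
    (is "?L = ?R")
  proof (intro equalityI subsetI)
    fix e assume "e \<in> ?L"
    then obtain u v where "e = Inl ` {u, v}" "u \<in> {1..n}" "v \<in> {1..n}" "u \<noteq> v"
      unfolding complete_graph_def ugraph.simps by blast
    moreover from this have "e = {Inl u, Inl v}" by simp
    ultimately show "e \<in> ?R" by blast
  next
    fix e assume "e \<in> ?R"
    then obtain u v where "e = {Inl u, Inl v}" and uv: "u \<in> {1..n}" "v \<in> {1..n}" "u \<noteq> v"
      by blast
    then have "e = Inl ` {u, v}" by simp
    with uv show "e \<in> ?L"
      unfolding complete_graph_def ugraph.simps by blast
  qed
  then show ?thesis
    by (simp add: corona_def edgeless_graph_def complete_graph_def)
qed

lemma stem_stem_edge_iff:
  "{Inl u, Inl v} \<in> edges (clique_corona n m) \<longleftrightarrow> u \<in> {1..n} \<and> v \<in> {1..n} \<and> u \<noteq> v"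
proof
  assume "{Inl u, Inl v} \<in> edges (clique_corona n m)"
  then show "u \<in> {1..n} \<and> v \<in> {1..n} \<and> u \<noteq> v"
    unfolding edges_clique_corona by (auto simp: doubleton_eq_iff)
next
  assume "u \<in> {1..n} \<and> v \<in> {1..n} \<and> u \<noteq> v"
  then show "{Inl u, Inl v} \<in> edges (clique_corona n m)"
    unfolding edges_clique_corona by blast
qed

lemma leaf_stem_edge_iff:
  "{Inr (u, w), Inl v} \<in> edges (clique_corona n m) \<longleftrightarrow> u = v \<and> v \<in> {1..n} \<and> w \<in> {1..m}"
  unfolding edges_clique_corona by (auto simp: doubleton_eq_iff)

lemma leaf_leaf_no_edge: "{Inr p, Inr q} \<notin> edges (clique_corona n m)"
  unfolding edges_clique_corona by (auto simp: doubleton_eq_iff)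

lemma closed_nbhd_stem:
  assumes "v \<in> {1..n}"
  shows "closed_nbhd (clique_corona n m) (Inl v) = Inl ` {1..n} \<union> Inr ` ({v} \<times> {1..m})"
proof (intro set_eqI)
  fix x
  show "x \<in> closed_nbhd (clique_corona n m) (Inl v)
      \<longleftrightarrow> x \<in> Inl ` {1..n} \<union> Inr ` ({v} \<times> {1..m})"
  proof (cases x)
    case (Inl u)
    then show ?thesis
      using assms by (auto simp: closed_nbhd_def stem_stem_edge_iff)
  next
    case (Inr p)
    then show ?thesis
      using assms by (cases p) (auto simp: closed_nbhd_def leaf_stem_edge_iff)
  qed
qed

lemma closed_nbhd_leaf:
  assumes "v \<in> {1..n}" "w \<in> {1..m}"
  shows "closed_nbhd (clique_corona n m) (Inr (v, w)) = {Inl v, Inr (v, w)}"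
proof (intro set_eqI)
  fix x
  show "x \<in> closed_nbhd (clique_corona n m) (Inr (v, w)) \<longleftrightarrow> x \<in> {Inl v, Inr (v, w)}"
  proof (cases x)
    case (Inl u)
    have "{x, Inr (v, w)} = {Inr (v, w), Inl u}" using Inl by blast
    then show ?thesis
      using assms Inl by (auto simp: closed_nbhd_def leaf_stem_edge_iff)
  next
    case (Inr p)
    then show ?thesis
      by (simp add: closed_nbhd_def leaf_leaf_no_edge)
  qed
qed

section \<open>Colourings with many colours\<close>

lemma leaf_numbering:
  obtains b :: "nat \<times> nat \<Rightarrow> nat" where "bij_betw b ({1..n} \<times> {1..m}) {1..m * n}"
proof -
  have "\<exists>b. bij_betw b ({1..n} \<times> {1..m}) {1..m * n}"
    by (rule finite_same_card_bij) (simp_all add: card_cartesian_product)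
  then show ?thesis using that by blast
qed

text \<open>Each coloured vertex is the only coloured vertex in its closed neighbourhood, as no two leaves
  are adjacent.\<close>

lemma rainbow_leaves_coloring: "\<exists>f. sub_quorum_coloring (clique_corona n m) (m * n) f"
proof -
  obtain b where b: "bij_betw b ({1..n} \<times> {1..m}) {1..m * n}"
    by (rule leaf_numbering)
  define f :: "nat + nat \<times> nat \<rightharpoonup> nat" where
    "f = case_sum (\<lambda>v. None) (\<lambda>p. if p \<in> {1..n} \<times> {1..m} then Some (b p) else None)"
  have "x \<in> dom f \<longleftrightarrow> x \<in> Inr ` ({1..n} \<times> {1..m})" for x
    by (cases x) (auto simp: f_def dom_def)
  then have dom: "dom f = Inr ` ({1..n} \<times> {1..m})"
    by (rule set_eqI)
  have "ran f = b ` ({1..n} \<times> {1..m})"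
  proof (intro equalityI subsetI)
    fix c assume "c \<in> ran f"
    then obtain x where "f x = Some c" by (auto simp: ran_def)
    then show "c \<in> b ` ({1..n} \<times> {1..m})"
      by (auto simp: f_def split: sum.splits if_splits)
  next
    fix c assume "c \<in> b ` ({1..n} \<times> {1..m})"
    then obtain p where "p \<in> {1..n} \<times> {1..m}" "c = b p" by blast
    then have "f (Inr p) = Some c" by (simp add: f_def)
    then show "c \<in> ran f" by (rule ranI)
  qed
  then have ran: "ran f = {1..m * n}"
    using b by (simp add: bij_betw_def)
  have quorum: "1/2 * real (card (closed_nbhd (clique_corona n m) x \<inter> dom f))
      \<le> real (card {u \<in> closed_nbhd (clique_corona n m) x \<inter> dom f. f u = f x})"
    if x_dom: "x \<in> dom f" for x
  proof -
    obtain v w where x: "x = Inr (v, w)" and vw: "v \<in> {1..n}" "w \<in> {1..m}"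
      using x_dom[unfolded dom] by auto
    have N: "closed_nbhd (clique_corona n m) x \<inter> dom f = {x}"
      unfolding x closed_nbhd_leaf[OF vw] dom using vw by auto
    have "{u \<in> {x}. f u = f x} = {x}" by auto
    then show ?thesis unfolding N by simp
  qed
  have "sub_quorum_coloring (clique_corona n m) (m * n) f"
    unfolding sub_quorum_coloring_def
    using dom ran quorum by (auto simp: verts_clique_corona)
  then show ?thesis by blast
qed

text \<open>Both kinds of vertex attain the quorum: a leaf is one of two, a stem sees its colour on
  \<open>n\<close> of \<open>n + m\<close>.\<close>

lemma rainbow_leaves_uniform_stems_coloring:
  assumes "1 \<le> n" "m \<le> n"
  shows "\<exists>f. sub_quorum_coloring (clique_corona n m) (m * n + 1) f"
proof -
  obtain b where b: "bij_betw b ({1..n} \<times> {1..m}) {1..m * n}"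
    by (rule leaf_numbering)
  define f :: "nat + nat \<times> nat \<rightharpoonup> nat" where
    "f = case_sum (\<lambda>v. if v \<in> {1..n} then Some (m * n + 1) else None)
                  (\<lambda>p. if p \<in> {1..n} \<times> {1..m} then Some (b p) else None)"
  have "x \<in> dom f \<longleftrightarrow> x \<in> Inl ` {1..n} \<union> Inr ` ({1..n} \<times> {1..m})" for x
    by (cases x) (auto simp: f_def dom_def)
  then have dom: "dom f = Inl ` {1..n} \<union> Inr ` ({1..n} \<times> {1..m})"
    by (rule set_eqI)
  have "ran f = insert (m * n + 1) (b ` ({1..n} \<times> {1..m}))"
  proof (intro equalityI subsetI)
    fix c assume "c \<in> ran f"
    then obtain x where "f x = Some c" by (auto simp: ran_def)
    then show "c \<in> insert (m * n + 1) (b ` ({1..n} \<times> {1..m}))"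
      by (auto simp: f_def split: sum.splits if_splits)
  next
    fix c assume "c \<in> insert (m * n + 1) (b ` ({1..n} \<times> {1..m}))"
    then consider "c = m * n + 1" | p where "p \<in> {1..n} \<times> {1..m}" "c = b p" by blast
    then show "c \<in> ran f"
    proof cases
      case 1
      then have "f (Inl 1) = Some c" using assms by (simp add: f_def)
      then show ?thesis by (rule ranI)
    next
      case 2
      then have "f (Inr p) = Some c" by (simp add: f_def)
      then show ?thesis by (rule ranI)
    qed
  qed
  then have ran: "ran f = {1..m * n + 1}"
    using b by (auto simp: bij_betw_def)
  have quorum: "1/2 * real (card (closed_nbhd (clique_corona n m) x \<inter> dom f))
      \<le> real (card {u \<in> closed_nbhd (clique_corona n m) x \<inter> dom f. f u = f x})"
    if x_dom: "x \<in> dom f" for x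
  proof -
    from x_dom[unfolded dom] consider v where "x = Inl v" "v \<in> {1..n}"
      | v w where "x = Inr (v, w)" "v \<in> {1..n}" "w \<in> {1..m}" by auto
    then show ?thesis
    proof cases
      case (1 v)
      define N where "N = closed_nbhd (clique_corona n m) x \<inter> dom f"
      have N: "N = Inl ` {1..n} \<union> Inr ` ({v} \<times> {1..m})"
        unfolding N_def 1(1) closed_nbhd_stem[OF 1(2)] dom using 1 by auto
      have "card N \<le> card (Inl ` {1..n} :: (nat + nat \<times> nat) set)
          + card (Inr ` ({v} \<times> {1..m}) :: (nat + nat \<times> nat) set)"
        unfolding N by (rule card_Un_le)
      also have "\<dots> = n + m"
        by (simp add: card_image card_cartesian_product)
      finally have total: "card N \<le> n + m" .
      have "Inl ` {1..n} \<subseteq> {u \<in> N. f u = f x}"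
        using 1 by (auto simp: N f_def)
      then have "card (Inl ` {1..n} :: (nat + nat \<times> nat) set) \<le> card {u \<in> N. f u = f x}"
        by (rule card_mono[rotated]) (simp add: N)
      then have "n \<le> card {u \<in> N. f u = f x}"
        by (simp add: card_image)
      with total assms show ?thesis
        unfolding N_def[symmetric] by linarith
    next
      case (2 v w)
      define N where "N = closed_nbhd (clique_corona n m) x \<inter> dom f"
      have N: "N = {Inl v, Inr (v, w)}"
        unfolding N_def 2(1) closed_nbhd_leaf[OF 2(2,3)] dom using 2 by auto
      have "{x} \<subseteq> {u \<in> N. f u = f x}" using 2 by (auto simp: N)
      then have "card {x} \<le> card {u \<in> N. f u = f x}"
        by (rule card_mono[rotated]) (simp add: N)
      moreover have "card N = 2" by (simp add: N)
      ultimately show ?thesis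
        unfolding N_def[symmetric] by simp
    qed
  qed
  have "sub_quorum_coloring (clique_corona n m) (m * n + 1) f"
    unfolding sub_quorum_coloring_def
    using dom ran quorum by (auto simp: verts_clique_corona)
  then show ?thesis by blast
qed

section \<open>The upper bound\<close>

fun represented_colour :: "(nat + nat \<times> nat \<rightharpoonup> nat) \<Rightarrow> nat \<times> nat \<Rightarrow> nat option" where
  "represented_colour f (v, w) = (if f (Inr (v, w)) = None then f (Inl v) else f (Inr (v, w)))"

text \<open>A stem \<open>v\<close> with an unrepresented colour sees that colour only on stems, while all
  of its \<open>m\<close> leaves are coloured and count against it; this is its quorum condition.\<close>

lemma unrepresented_colour_majority:
  assumes col: "sub_quorum_coloring (clique_corona n m) k f"
    and c: "c \<in> ran f"
    and unrep: "Some c \<notin> represented_colour f ` ({1..n} \<times> {1..m})"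
  shows "card {u. Inl u \<in> dom f} + m \<le> 2 * card {u. f (Inl u) = Some c}"
proof -
  have dom: "dom f \<subseteq> Inl ` {1..n} \<union> Inr ` ({1..n} \<times> {1..m})"
    using col by (simp add: sub_quorum_coloring_def verts_clique_corona)
  have not_leaf: "f (Inr (v, w)) \<noteq> Some c" if "v \<in> {1..n}" "w \<in> {1..m}" for v w
  proof
    assume "f (Inr (v, w)) = Some c"
    then have "represented_colour f (v, w) = Some c" by simp
    with that unrep show False by (metis SigmaI image_eqI)
  qed
  obtain x where fx: "f x = Some c" using c by (auto simp: ran_def)
  then have "x \<in> dom f" by blast
  with dom fx not_leaf obtain v where x: "x = Inl v" and v: "v \<in> {1..n}" by auto
  have coloured: "f (Inr (v, w)) \<noteq> None" if "w \<in> {1..m}" for w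
  proof
    assume "f (Inr (v, w)) = None"
    then have "represented_colour f (v, w) = Some c" using fx x by simp
    with v that unrep show False by (metis SigmaI image_eqI)
  qed
  define N where "N = closed_nbhd (clique_corona n m) x \<inter> dom f"
  have N: "N = Inl ` {u. Inl u \<in> dom f} \<union> Inr ` ({v} \<times> {1..m})"
    unfolding N_def x closed_nbhd_stem[OF v] using dom coloured by auto
  have fin: "finite {u. Inl u \<in> dom f}"
    by (rule finite_subset[of _ "{1..n}"]) (use dom in auto)
  have "card N = card (Inl ` {u. Inl u \<in> dom f} :: (nat + nat \<times> nat) set)
      + card (Inr ` ({v} \<times> {1..m}) :: (nat + nat \<times> nat) set)"
    unfolding N by (rule card_Un_disjoint) (use fin in auto)
  also have "\<dots> = card {u. Inl u \<in> dom f} + m"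
    by (simp add: card_image card_cartesian_product)
  finally have total: "card N = card {u. Inl u \<in> dom f} + m" .
  have "{u \<in> N. f u = f x} = Inl ` {u. f (Inl u) = Some c}"
    using not_leaf v fx by (auto simp: N)
  then have same: "card {u \<in> N. f u = f x} = card {u. f (Inl u) = Some c}"
    by (simp add: card_image)
  have "1/2 * real (card N) \<le> real (card {u \<in> N. f u = f x})"
    using col \<open>x \<in> dom f\<close> unfolding sub_quorum_coloring_def N_def by blast
  with total same show ?thesis by linarith
qed

text \<open>Colours are counted as represented (at most one per leaf) or unrepresented (at most one, a
  strict majority among the coloured stems, and none if the \<open>m\<close> leaves at a stem outnumber all stems).\<close>

lemma coloring_size_le:
  assumes col: "sub_quorum_coloring (clique_corona n m) k f" and "1 \<le> m"
  shows "k \<le> (if n < m then m * n else m * n + 1)"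
proof -
  define R where "R = represented_colour f ` ({1..n} \<times> {1..m})"
  define U where "U = {c \<in> ran f. Some c \<notin> R}"
  define A where "A = {u. Inl u \<in> dom f}"
  define D where "D c = {u. f (Inl u) = Some c}" for c
  have ran: "ran f = {1..k}" using col by (simp add: sub_quorum_coloring_def)
  have sub: "A \<subseteq> {1..n}"
    using col by (auto simp: sub_quorum_coloring_def verts_clique_corona A_def)
  then have fin: "finite A" by (rule finite_subset) simp
  have DA: "D c \<subseteq> A" for c by (auto simp: D_def A_def)
  have major: "card A + m \<le> 2 * card (D c)" if "c \<in> U" for c
    using unrepresented_colour_majority[OF col] that by (simp add: U_def R_def A_def D_def)
  have "card R \<le> card ({1..n} \<times> {1..m})"
    unfolding R_def by (rule card_image_le) simp
  then have R: "card R \<le> m * n" "finite R"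
    by (simp_all add: card_cartesian_product R_def mult.commute)
  have U_unique: "c = d" if "c \<in> U" "d \<in> U" for c d
  proof (rule ccontr)
    assume "c \<noteq> d"
    then have "card (D c) + card (D d) = card (D c \<union> D d)"
      by (intro card_Un_disjoint[symmetric])
        (use DA fin in \<open>auto simp: D_def intro: finite_subset\<close>)
    also have "\<dots> \<le> card A" by (rule card_mono) (use DA fin in auto)
    finally show False using major[OF that(1)] major[OF that(2)] \<open>1 \<le> m\<close> by linarith
  qed
  have U_empty: "U = {}" if "n < m"
  proof (rule ccontr)
    assume "U \<noteq> {}"
    then obtain c where "c \<in> U" by blast
    moreover have "card (D c) \<le> card A" by (rule card_mono[OF fin DA])
    moreover have "card A \<le> n" using card_mono[OF _ sub] by simp
    ultimately show False using major[of c] \<open>n < m\<close> by linarith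
  qed
  have finU: "finite U" by (simp add: U_def ran)
  have "card U \<le> 1"
    using U_unique by (simp add: card_le_Suc0_iff_eq[OF finU])
  with U_empty have U: "card U \<le> (if n < m then 0 else 1)" by simp
  have "Some ` ran f \<subseteq> R \<union> Some ` U" by (auto simp: U_def)
  then have "card (Some ` ran f) \<le> card (R \<union> Some ` U)"
    by (rule card_mono[rotated]) (simp add: R finU)
  also have "\<dots> \<le> card R + card (Some ` U)" by (rule card_Un_le)
  finally have "k \<le> card R + card U" by (simp add: card_image ran)
  with R U show ?thesis by (simp split: if_splits)
qed

theorem psi_sq_clique_corona:
  assumes "1 \<le> n" "1 \<le> m"
  shows "psi_sq (clique_corona n m) = (if n < m then m * n else m * n + 1)"
  unfolding psi_sq_def
proof (rule Max_eqI)
  show "finite {k. \<exists>f. sub_quorum_coloring (clique_corona n m) k f}"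
    by (intro finite_sub_quorum_numbers simple_graph_corona simple_graph_complete_graph
        simple_graph_edgeless_graph)
next
  fix k assume "k \<in> {k. \<exists>f. sub_quorum_coloring (clique_corona n m) k f}"
  then show "k \<le> (if n < m then m * n else m * n + 1)"
    using coloring_size_le[OF _ assms(2)] by blast
next
  show "(if n < m then m * n else m * n + 1) \<in> {k. \<exists>f. sub_quorum_coloring (clique_corona n m) k f}"
    using rainbow_leaves_coloring rainbow_leaves_uniform_stems_coloring[OF assms(1)] by simp
qed

section \<open>The closed formula\<close>

text \<open>If \<open>m \<le> n\<close>, then \<open>x = n / m \<ge> 1\<close> and \<open>0 < \<lfloor>x\<rfloor> / x \<le> 1\<close>; otherwise \<open>\<lfloor>x\<rfloor> = 0\<close>.\<close>

lemma ceiling_ratio_indicator: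
  fixes n m :: nat
  assumes "1 \<le> n" "1 \<le> m"
  shows "\<lceil>real m / real n * real_of_int \<lfloor>real n / real m\<rfloor>\<rceil> = (if n < m then 0 else 1)"
proof (cases "n < m")
  case True
  then have "\<lfloor>real n / real m\<rfloor> = 0"
    by (simp add: floor_eq_iff)
  with True show ?thesis by simp
next
  case False
  have pos: "0 < real m / real n" using assms by simp
  have "1 \<le> \<lfloor>real n / real m\<rfloor>"
    using False assms by (simp add: le_floor_iff)
  then have lo: "0 < real m / real n * real_of_int \<lfloor>real n / real m\<rfloor>"
    using pos by (intro mult_pos_pos) simp_all
  have "real m / real n * real_of_int \<lfloor>real n / real m\<rfloor> \<le> real m / real n * (real n / real m)"
    using pos by (intro mult_left_mono) simp_all
  also have "\<dots> = 1" using assms by simp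
  finally have "\<lceil>real m / real n * real_of_int \<lfloor>real n / real m\<rfloor>\<rceil> = 1"
    using lo by (simp add: ceiling_eq_iff)
  with False show ?thesis by simp
qed

theorem theorem5p12:
  fixes n m :: nat
  assumes "1 \<le> n" and "1 \<le> m"
  shows "int (psi_sq (corona (complete_graph n) (edgeless_graph m)))
           = int (m * n) + \<lceil>real m / real n * real_of_int \<lfloor>real n / real m\<rfloor>\<rceil>
       \<and> int (m * n) + \<lceil>real m / real n * real_of_int \<lfloor>real n / real m\<rfloor>\<rceil>
           = (if n < m then int (m * n) else int (m * n) + 1)"
  unfolding psi_sq_clique_corona[OF assms] ceiling_ratio_indicator[OF assms] by simp

end
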